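(* Let $\mathbb{A}$ be a finite non-empty set and let $x\in \mathbb{A}^{\mathbb{N}}$ be an aperiodic infinite word. Then for every infinite sequence $\omega=(G_n)_{n\geq 1}$, where each $G_n$ is a subgroup of the symmetric group $S_n$, we have $p_{\omega,x}(n)\geq \epsilon(G_n)+1$ for each $n\geq 1$. Moreover, if $p_{\omega,x}(n)=\epsilon(G_n)+1$ for each $n\geq 1$, then $x$ is Sturmian.
   Context: $S_n$ is the group of all bijections of $\{1,2,\ldots,n\}$. For a subgroup $G\subseteq S_n$, $\epsilon(G)$ denotes the number of distinct orbits of $G$ acting on $\{1,2,\ldots,n\}$ by $g*i=g(i)$. $\mathbb{A}^n$ is the set of words $u=u_1u_2\cdots u_n$ with $u_i\in\mathbb{A}$. $G$ acts on $\mathbb{A}^n$ by $g*u=u_{g^{-1}(1)}u_{g^{-1}(2)}\cdots u_{g^{-1}(n)}$. For an infinite word $x=x_0x_1x_2\cdots\in\mathbb{A}^{\mathbb{N}}$, $\mathrm{Fact}_x(n)=\{x_ix_{i+1}\cdots x_{i+n-1}\mid i\geq 0\}$ is the set of factors of $x$ of length $n$. For $u,v\in \mathrm{Fact}_x(n)$, write $u\sim_G v$ if $g*u=v$ for some $g\in G$. For a sequence $\omega=(G_n)_{n\geq1}$ of subgroups $G_n\subseteq S_n$, $p_{\omega,x}(n)=\mathrm{Card}(\mathrm{Fact}_x(n)/\sim_{G_n})$ is the number of $\sim_{G_n}$-equivalence classes of factors of $x$ of length $n$. An infinite word is aperiodic if it is not ultimately periodic. It is binary if exactly two distinct letters occur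 in it. It is balanced if for every pair of factors $u,v$ of $x$ of equal length and every letter $a$ we have $\big||u|_a-|v|_a\big|\leq 1$, where $|u|_a$ is the number of occurrences of $a$ in $u$. An infinite word is Sturmian if it is aperiodic, binary and balanced (equivalently, it has exactly $n+1$ distinct factors of each length $n$). *)

theory Defs
  imports "HOL-Algebra.Sym_Groups" "HOL-Algebra.Group_Action"
begin

text \<open>
  An infinite word is a function \<open>x :: nat \<Rightarrow> 'a\<close>; a finite word is a list. The letters of a
  finite word are numbered from 1 in the mathematics, so the letter \<open>u\<^sub>i\<close> is \<open>u ! (i - 1)\<close>.
\<close>

definition factors :: "(nat \<Rightarrow> 'a) \<Rightarrow> nat \<Rightarrow> 'a list set" where
  "factors x n = {map x [i..<i + n] | i. True}"

definition ultimately_periodic :: "(nat \<Rightarrow> 'a) \<Rightarrow> bool" where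
  "ultimately_periodic x \<longleftrightarrow> (\<exists>p>0. \<exists>N. \<forall>i\<ge>N. x (i + p) = x i)"

definition aperiodic :: "(nat \<Rightarrow> 'a) \<Rightarrow> bool" where
  "aperiodic x \<longleftrightarrow> \<not> ultimately_periodic x"

definition binary :: "(nat \<Rightarrow> 'a) \<Rightarrow> bool" where
  "binary x \<longleftrightarrow> card (range x) = 2"

definition balanced :: "(nat \<Rightarrow> 'a) \<Rightarrow> bool" where
  "balanced x \<longleftrightarrow> (\<forall>n. \<forall>u \<in> factors x n. \<forall>v \<in> factors x n. \<forall>a.
     \<bar>int (count_list u a) - int (count_list v a)\<bar> \<le> 1)"

definition sturmian :: "(nat \<Rightarrow> 'a) \<Rightarrow> bool" where
  "sturmian x \<longleftrightarrow> aperiodic x \<and> binary x \<and> balanced x"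

text \<open>
  A subgroup of the symmetric group is given by its carrier \<open>H\<close>, as in \<^const>\<open>subgroup\<close>.
  It acts on \<open>{1..n}\<close> by evaluation.
\<close>

definition num_orbits :: "nat \<Rightarrow> (nat \<Rightarrow> nat) set \<Rightarrow> nat" where
  "num_orbits n H = card (orbits ((sym_group n)\<lparr>carrier := H\<rparr>) {1..n} (\<lambda>g i. g i))"

definition word_action :: "(nat \<Rightarrow> nat) \<Rightarrow> 'a list \<Rightarrow> 'a list" where
  "word_action g u = map (\<lambda>i. u ! (inv' g i - 1)) [1..<length u + 1]"

definition factor_rel :: "(nat \<Rightarrow> nat) set \<Rightarrow> (nat \<Rightarrow> 'a) \<Rightarrow> nat \<Rightarrow> ('a list \<times> 'a list) set" where
  "factor_rel H x n =
     {(u, v). u \<in> factors x n \<and> v \<in> factors x n \<and> (\<exists>g \<in> H. word_action g u = v)}"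

definition group_complexity :: "(nat \<Rightarrow> (nat \<Rightarrow> nat) set) \<Rightarrow> (nat \<Rightarrow> 'a) \<Rightarrow> nat \<Rightarrow> nat" where
  "group_complexity \<omega> x n = card (factors x n // factor_rel (\<omega> n) x n)"

end

theory Submission
  imports Defs Complex_Main
begin

text \<open>
  Weight the letters by pairwise distinct real numbers and attach to every factor of length \<open>n\<close> the
  vector of its orbit sums: for each orbit of the group on the positions, the total weight of the
  letters found there. Permuting the positions by the group does not change this vector, so there
  are at least as many classes as vectors. The lower bound is now linear algebra. With \<open>k\<close> orbits,
  any \<open>k\<close> vectors or fewer lie on an affine hyperplane. A hyperplane that contains the vectors of all
  factors is a linear recurrence with constant coefficients for the weights of the letters of the
  infinite word, and since these take finitely many values, the recurrence makes the word
  ultimately periodic (\<open>orbit_sums_in_hyperplane_imp_periodic\<close>). An aperiodic word therefore has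
  at least \<open>k + 1\<close> vectors, whatever the group is.

  If equality holds for all lengths, length 1 shows that the word is binary. Suppose that it is
  not balanced. The classical study of a shortest unbalanced pair gives a word \<open>w\<close> such that
  \<open>awa\<close> and \<open>bwb\<close> are factors, while all pairs of shorter factors are balanced. Aperiodicity forces
  \<open>awb\<close> and \<open>bwa\<close> to be factors as well (\<open>both_extensions_of_core\<close>). The vectors of these four words
  form a parallelogram, possibly a degenerate one: the vector of \<open>bwb\<close> is an affine combination of
  the other three, and differs from each of them. Leaving it out does not change the affine hull,
  so there are at least \<open>k + 2\<close> vectors at this length, whatever the group is, and equality fails
  (\<open>unbalanced_core_excess_orbit_sums\<close>).
\<close>

section \<open>Linear algebra\<close>

lemma homogeneous_system_nontrivial_solution:
  fixes M :: "'e \<Rightarrow> 'u \<Rightarrow> 'f::field"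
  assumes "finite E" and "finite U" and "card E < card U"
  shows "\<exists>c. (\<exists>u\<in>U. c u \<noteq> 0) \<and> (\<forall>e\<in>E. (\<Sum>u\<in>U. c u * M e u) = 0)"
  using assms
proof (induction E arbitrary: U M rule: finite_induct)
  case empty
  then have "U \<noteq> {}" by auto
  then show ?case by (intro exI[of _ "\<lambda>_. 1"]) auto
next
  case (insert e E)
  show ?case
  proof (cases "\<forall>u\<in>U. M e u = 0")
    case True
    obtain c where "\<exists>u\<in>U. c u \<noteq> 0" "\<forall>e\<in>E. (\<Sum>u\<in>U. c u * M e u) = 0"
      using insert.IH[of U M] insert.prems insert.hyps by auto
    then show ?thesis using True by (intro exI[of _ c]) auto
  next
    case False
    then obtain u0 where u0: "u0 \<in> U" "M e u0 \<noteq> 0" by auto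
    \<comment> \<open>Gaussian elimination with pivot \<open>M e u0\<close>: the other equations are freed of the
      unknown \<open>u0\<close>, and equation \<open>e\<close> fixes its value at the end.\<close>
    define U' where "U' = U - {u0}"
    have fin: "finite U'" "card E < card U'"
      using insert u0 by (auto simp: U'_def)
    obtain c where c: "\<exists>u\<in>U'. c u \<noteq> 0"
      "\<forall>e'\<in>E. (\<Sum>u\<in>U'. c u * (M e' u - M e' u0 * M e u / M e u0)) = 0"
      using insert.IH[OF fin, of "\<lambda>e' u. M e' u - M e' u0 * M e u / M e u0"] by blast
    define S where "S = (\<Sum>u\<in>U'. c u * M e u)"
    define c' where "c' = c(u0 := - S / M e u0)"
    have split: "(\<Sum>u\<in>U. c' u * M e' u) = - S / M e u0 * M e' u0 + (\<Sum>u\<in>U'. c u * M e' u)"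
      for e'
    proof -
      have "(\<Sum>u\<in>U'. c' u * M e' u) = (\<Sum>u\<in>U'. c u * M e' u)"
        by (rule sum.cong) (auto simp: c'_def U'_def)
      then show ?thesis
        using insert.prems(1) u0(1) by (simp add: sum.remove[of U u0] U'_def c'_def)
    qed
    have "(\<Sum>u\<in>U. c' u * M e' u) = 0" if "e' \<in> E" for e'
    proof -
      have "0 = (\<Sum>u\<in>U'. c u * M e' u - M e' u0 / M e u0 * (c u * M e u))"
        using c(2) that by (simp add: algebra_simps)
      also have "\<dots> = (\<Sum>u\<in>U'. c u * M e' u) - M e' u0 / M e u0 * S"
        by (simp add: sum_subtractf sum_distrib_left S_def)
      finally show ?thesis by (simp add: split)
    qed
    moreover have "(\<Sum>u\<in>U. c' u * M e u) = 0"
      using u0 by (simp add: split S_def)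
    moreover have "\<exists>u\<in>U. c' u \<noteq> 0"
      using c(1) by (auto simp: c'_def U'_def)
    ultimately show ?thesis by blast
  qed
qed

text \<open>
  Subtracting one of the points makes the remaining \<open>card V - 1\<close> conditions on the normal vector
  homogeneous.
\<close>

lemma few_points_on_hyperplane:
  fixes V :: "('j \<Rightarrow> 'f::field) set"
  assumes "finite J" and "finite V" and "V \<noteq> {}" and "card V \<le> card J"
  shows "\<exists>c d. (\<exists>j\<in>J. c j \<noteq> 0) \<and> (\<forall>v\<in>V. (\<Sum>j\<in>J. c j * v j) = d)"
proof -
  obtain v0 where v0: "v0 \<in> V" using assms(3) by blast
  have "card V \<noteq> 0" using assms by auto
  then have "card (V - {v0}) < card J"
    using assms v0 card_Diff1_less[of V v0] by linarith
  then obtain c where c: "\<exists>j\<in>J. c j \<noteq> 0"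
    "\<forall>v\<in>V - {v0}. (\<Sum>j\<in>J. c j * (v j - v0 j)) = 0"
    using homogeneous_system_nontrivial_solution[of "V - {v0}" J "\<lambda>v j. v j - v0 j"] assms
    by auto
  have "(\<Sum>j\<in>J. c j * v j) = (\<Sum>j\<in>J. c j * v0 j)" if "v \<in> V" for v
    using c(2) that by (cases "v = v0") (auto simp: algebra_simps sum_subtractf)
  with c(1) show ?thesis by blast
qed

section \<open>Periodicity\<close>

text \<open>
  A state whose successor is determined by the state alone, repeated along a cycle of such states,
  can never leave the cycle. Determinism is only asked of the states on the cycle, because an
  infinite word may well branch at other factors.
\<close>

lemma periodic_from_deterministic_cycle:
  fixes s :: "nat \<Rightarrow> 's"
  assumes "i < j" and "s i = s j"
    and det: "\<And>k m. i \<le> k \<Longrightarrow> k < j \<Longrightarrow> s m = s k \<Longrightarrow> s (Suc m) = s (Suc k)"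
    and "i \<le> m"
  shows "s (m + (j - i)) = s m"
proof -
  have "s (m + (j - i)) = s m \<and> (\<exists>k. i \<le> k \<and> k < j \<and> s m = s k)"
    using \<open>i \<le> m\<close>
  proof (induction m rule: dec_induct)
    case base
    then show ?case using assms(1,2) by auto
  next
    case (step m)
    then obtain k where k: "i \<le> k" "k < j" "s m = s k" "s (m + (j - i)) = s k" by auto
    have "s (Suc m) = s (Suc k)" "s (Suc (m + (j - i))) = s (Suc k)"
      using det[OF k(1,2,3)] det[OF k(1,2,4)] by simp_all
    moreover have "\<exists>k'. i \<le> k' \<and> k' < j \<and> s (Suc k) = s k'"
    proof (cases "Suc k = j")
      case True
      then show ?thesis using assms(1,2) by (intro exI[of _ i]) simp
    next
      case False
      then show ?thesis using k by (intro exI[of _ "Suc k"]) simp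
    qed
    ultimately show ?case by simp
  qed
  then show ?thesis by blast
qed

abbreviation window :: "(nat \<Rightarrow> 'a) \<Rightarrow> nat \<Rightarrow> nat \<Rightarrow> 'a list" where
  "window x l i \<equiv> map x [i..<i + l]"

lemma window_eq_iff: "window x l i = window x l j \<longleftrightarrow> (\<forall>k<l. x (i + k) = x (j + k))"
  by (auto simp: list_eq_iff_nth_eq)

lemma window_Suc_eqI:
  assumes "window x l i = window x l j" and "x (i + l) = x (j + l)"
  shows "window x l (Suc i) = window x l (Suc j)"
  unfolding window_eq_iff
proof (intro allI impI)
  fix k assume "k < l"
  then show "x (Suc i + k) = x (Suc j + k)"
    using assms(1)[unfolded window_eq_iff, rule_format, of "Suc k"] assms(2)
    by (cases "Suc k = l") auto
qed

lemma ultimately_periodic_from_windows: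
  assumes "0 < l" and "i < j" and "window x l i = window x l j"
    and det: "\<And>k m. i \<le> k \<Longrightarrow> k < j \<Longrightarrow> window x l m = window x l k \<Longrightarrow> x (m + l) = x (k + l)"
  shows "ultimately_periodic x"
proof -
  have "window x l (m + (j - i)) = window x l m" if "i \<le> m" for m
  proof (rule periodic_from_deterministic_cycle[of i j "window x l" m, OF assms(2,3) _ that])
    fix k m assume *: "i \<le> k" "k < j" "window x l m = window x l k"
    then show "window x l (Suc m) = window x l (Suc k)"
      using window_Suc_eqI[OF *(3)] det[OF *] by blast
  qed
  then have "x (m + (j - i) + 0) = x (m + 0)" if "i \<le> m" for m
    using that \<open>0 < l\<close> unfolding window_eq_iff by blast
  then show ?thesis
    unfolding ultimately_periodic_def using \<open>i < j\<close>
    by (intro exI[of _ "j - i"]) auto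
qed

lemma finite_factors:
  assumes "finite (range x)"
  shows "finite (factors x n)"
proof (rule finite_subset)
  show "factors x n \<subseteq> {u. set u \<subseteq> range x \<and> length u = n}" by (auto simp: factors_def)
  show "finite {u. set u \<subseteq> range x \<and> length u = n}" using finite_lists_length_eq[OF assms] .
qed

text \<open>
  Solving for the last letter with a nonzero coefficient, a window of the word determines the next
  letter, and by finiteness some window is repeated.
\<close>

lemma ultimately_periodic_from_recurrence:
  fixes h :: "'a \<Rightarrow> 'f::field"
  assumes fin: "finite (range x)" and inj: "inj_on h (range x)"
    and "i0 < n" and "\<kappa> i0 \<noteq> 0"
    and rec: "\<And>m. (\<Sum>i<n. \<kappa> i * h (x (m + i))) = d"
  shows "ultimately_periodic x"
proof -
  define r where "r = Max {i. i < n \<and> \<kappa> i \<noteq> 0}"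
  have "r \<in> {i. i < n \<and> \<kappa> i \<noteq> 0}"
    unfolding r_def by (rule Max_in) (use assms(3,4) in auto)
  then have r: "r < n" "\<kappa> r \<noteq> 0" by simp_all
  have zero: "\<kappa> i = 0" if "r < i" "i < n" for i
  proof (rule ccontr)
    assume "\<kappa> i \<noteq> 0"
    then have "i \<le> r" unfolding r_def using that by (intro Max_ge) auto
    then show False using that by simp
  qed
  have rec': "(\<Sum>i<r. \<kappa> i * h (x (m + i))) + \<kappa> r * h (x (m + r)) = d" for m
  proof -
    have "(\<Sum>i<n. \<kappa> i * h (x (m + i))) = (\<Sum>i<Suc r. \<kappa> i * h (x (m + i)))"
      by (rule sum.mono_neutral_right) (use r zero in \<open>auto simp: not_less_eq\<close>)
    then show ?thesis using rec[of m] by simp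
  qed
  have next_letter: "x (m + r) = x (k + r)" if "\<And>i. i < r \<Longrightarrow> x (m + i) = x (k + i)" for m k
  proof -
    have "(\<Sum>i<r. \<kappa> i * h (x (m + i))) = (\<Sum>i<r. \<kappa> i * h (x (k + i)))"
      using that by (intro sum.cong) auto
    then have "(\<Sum>i<r. \<kappa> i * h (x (k + i))) + \<kappa> r * h (x (m + r))
        = (\<Sum>i<r. \<kappa> i * h (x (k + i))) + \<kappa> r * h (x (k + r))"
      using rec'[of m] rec'[of k] by simp
    then have "\<kappa> r * h (x (m + r)) = \<kappa> r * h (x (k + r))" by (rule add_left_imp_eq)
    then show ?thesis using r(2) inj by (auto dest: inj_onD)
  qed
  \<comment> \<open>Length \<open>r + 1\<close>, and not \<open>r\<close>, so that the window is not empty even if \<open>r = 0\<close>.\<close>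
  let ?s = "window x (Suc r)"
  have "finite (range ?s)"
    using finite_factors[OF fin, of "Suc r"] by (simp add: factors_def full_SetCompr_eq)
  then have "\<not> inj ?s" using finite_imageD[of ?s UNIV] infinite_UNIV_nat by auto
  then obtain i j where "i < j" "?s i = ?s j"
    by (meson linorder_injI)
  show ?thesis
  proof (rule ultimately_periodic_from_windows[OF zero_less_Suc \<open>i < j\<close> \<open>?s i = ?s j\<close>])
    fix k m
    assume "?s m = ?s k"
    then have "x (Suc m + i) = x (Suc k + i)" if "i < r" for i
      using \<open>?s m = ?s k\<close>[unfolded window_eq_iff, rule_format, of "Suc i"] that by simp
    from next_letter[OF this] show "x (m + Suc r) = x (k + Suc r)" by simp
  qed
qed

section \<open>Orbit sums\<close>

definition point_orbit :: "(nat \<Rightarrow> nat) set \<Rightarrow> nat \<Rightarrow> nat set" where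
  "point_orbit H i = (\<lambda>g. g i) ` H"

definition point_orbits :: "(nat \<Rightarrow> nat) set \<Rightarrow> nat \<Rightarrow> nat set set" where
  "point_orbits H n = point_orbit H ` {1..n}"

lemma num_orbits_eq: "num_orbits n H = card (point_orbits H n)"
proof -
  have "orbits ((sym_group n)\<lparr>carrier := H\<rparr>) {1..n} (\<lambda>g i. g i) = point_orbits H n"
    by (auto simp: orbits_def orbit_def point_orbits_def point_orbit_def image_def)
  then show ?thesis by (simp add: num_orbits_def)
qed

lemma sym_subgroup:
  assumes "subgroup H (sym_group n)"
  shows "g \<in> H \<Longrightarrow> g permutes {1..n}" and "id \<in> H"
    and "g \<in> H \<Longrightarrow> g' \<in> H \<Longrightarrow> g \<circ> g' \<in> H" and "g \<in> H \<Longrightarrow> inv' g \<in> H"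
proof -
  interpret subgroup H "sym_group n" by fact
  show perm: "g permutes {1..n}" if "g \<in> H"
    using that subset sym_group_carrier by blast
  show "id \<in> H" using one_closed by (simp add: sym_group_one)
  show "g \<in> H \<Longrightarrow> g' \<in> H \<Longrightarrow> g \<circ> g' \<in> H" using m_closed by (simp add: sym_group_mult)
  show "inv' g \<in> H" if "g \<in> H"
    using m_inv_closed[OF that] that subset sym_group_inv_equality[of g n] by auto
qed

lemma point_orbit_self: "subgroup H (sym_group n) \<Longrightarrow> i \<in> point_orbit H i"
  unfolding point_orbit_def using sym_subgroup(2)[of H n] by (metis id_apply image_eqI)

lemma point_orbit_image:
  assumes "subgroup H (sym_group n)" and "g \<in> H"
  shows "point_orbit H (g i) = point_orbit H i"
proof
  show "point_orbit H (g i) \<subseteq> point_orbit H i"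
  proof
    fix j assume "j \<in> point_orbit H (g i)"
    then obtain g' where "g' \<in> H" "j = (g' \<circ> g) i" by (auto simp: point_orbit_def)
    then show "j \<in> point_orbit H i"
      using sym_subgroup(3)[OF assms(1) _ assms(2)] unfolding point_orbit_def by blast
  qed
  show "point_orbit H i \<subseteq> point_orbit H (g i)"
  proof
    fix j assume "j \<in> point_orbit H i"
    then obtain g' where "g' \<in> H" "j = g' i" by (auto simp: point_orbit_def)
    moreover have "inv' g (g i) = i"
      using sym_subgroup(1)[OF assms] by (simp add: permutes_inverses(2))
    ultimately have "j = (g' \<circ> inv' g) (g i)" "g' \<circ> inv' g \<in> H"
      using sym_subgroup(3,4)[OF assms(1)] assms(2) by auto
    then show "j \<in> point_orbit H (g i)" unfolding point_orbit_def by blast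
  qed
qed

text \<open>
  This is the partition of the positions into orbits, in the form in which sums over the positions
  can be grouped.
\<close>

lemma point_orbit_eq_fibre:
  assumes H: "subgroup H (sym_group n)" and "P \<in> point_orbits H n"
  shows "P = {i \<in> {1..n}. point_orbit H i = P}"
proof -
  obtain j where j: "j \<in> {1..n}" "P = point_orbit H j"
    using assms(2) by (auto simp: point_orbits_def)
  have "g j \<in> {1..n}" if "g \<in> H" for g
    using permutes_in_image[OF sym_subgroup(1)[OF H that]] j(1) by blast
  moreover have "P = (\<lambda>g. g j) ` H" using j(2) by (simp add: point_orbit_def)
  ultimately have "P \<subseteq> {i \<in> {1..n}. point_orbit H i = P}"
    using point_orbit_image[OF H, of _ j] j(2) by blast
  moreover have "{i \<in> {1..n}. point_orbit H i = P} \<subseteq> P"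
    using point_orbit_self[OF H] by auto
  ultimately show ?thesis by blast
qed

lemma finite_point_orbits: "finite (point_orbits H n)"
  by (simp add: point_orbits_def)

text \<open>
  Letters are weighted by real numbers. The value outside the set of orbits is fixed by \<open>restrict\<close>
  so that equality of these functions means equality of all orbit sums and nothing more.
\<close>

definition orbit_sums :: "('a \<Rightarrow> real) \<Rightarrow> (nat \<Rightarrow> nat) set \<Rightarrow> nat \<Rightarrow> 'a list \<Rightarrow> nat set \<Rightarrow> real" where
  "orbit_sums h H n u = (\<lambda>P\<in>point_orbits H n. \<Sum>i\<in>P. h (u ! (i - 1)))"

lemma orbit_sums_word_action:
  assumes H: "subgroup H (sym_group n)" and g: "g \<in> H" and len: "length u = n"
  shows "orbit_sums h H n (word_action g u) = orbit_sums h H n u"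
  unfolding orbit_sums_def
proof (rule restrict_ext)
  fix P assume P: "P \<in> point_orbits H n"
  note perm = sym_subgroup(1)[OF H]
  have sub: "P \<subseteq> {1..n}" using point_orbit_eq_fibre[OF H P] by blast
  have maps: "g' i \<in> P" if "g' \<in> H" "i \<in> P" for g' i
    using point_orbit_eq_fibre[OF H P] point_orbit_image[OF H that(1)]
      permutes_in_image[OF perm[OF that(1)]] that(2) by blast
  have "(\<Sum>i\<in>P. h (word_action g u ! (i - 1))) = (\<Sum>i\<in>P. h (u ! (inv' g i - 1)))"
  proof (rule sum.cong)
    fix i assume "i \<in> P"
    then have "1 \<le> i" "i \<le> n" using sub by auto
    then have "i - 1 < n" "1 + (i - 1) = i" by auto
    then show "h (word_action g u ! (i - 1)) = h (u ! (inv' g i - 1))"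
      by (simp add: word_action_def len del: upt_Suc)
  qed simp
  also have "\<dots> = (\<Sum>i\<in>P. h (u ! (i - 1)))"
    by (rule sum.reindex_bij_witness[of _ g "inv' g"])
      (use maps g sym_subgroup(4)[OF H] perm[OF g] in \<open>auto simp: permutes_inverses\<close>)
  finally show "(\<Sum>i\<in>P. h (word_action g u ! (i - 1))) = (\<Sum>i\<in>P. h (u ! (i - 1)))" .
qed

text \<open>
  The vector of orbit sums is an invariant of the equivalence classes, and it can be read off from
  any chosen representative.
\<close>

lemma card_orbit_sums_le_group_complexity:
  assumes H: "subgroup (\<omega> n) (sym_group n)" and fin: "finite (range x)"
  shows "card (orbit_sums h (\<omega> n) n ` factors x n) \<le> group_complexity \<omega> x n"
proof -
  let ?F = "factors x n" and ?R = "factor_rel (\<omega> n) x n" and ?v = "orbit_sums h (\<omega> n) n"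
  have refl: "(u, u) \<in> ?R" if "u \<in> ?F" for u
  proof -
    have "length u = n" using that by (auto simp: factors_def)
    then have "word_action id u = u" by (auto simp: word_action_def list_eq_iff_nth_eq simp del: upt_Suc)
    then show ?thesis using that sym_subgroup(2)[OF H] by (auto simp: factor_rel_def)
  qed
  have "?v u \<in> (\<lambda>C. ?v (SOME w. w \<in> C)) ` (?F // ?R)" if u: "u \<in> ?F" for u
  proof -
    have "(SOME w. w \<in> ?R `` {u}) \<in> ?R `` {u}"
      using refl[OF u] unfolding some_in_eq by blast
    then obtain g where "g \<in> \<omega> n" "(SOME w. w \<in> ?R `` {u}) = word_action g u"
      unfolding factor_rel_def by blast
    moreover have "length u = n" using u by (auto simp: factors_def)
    ultimately have "?v u = ?v (SOME w. w \<in> ?R `` {u})"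
      using orbit_sums_word_action[OF H, of g u h] by simp
    then show ?thesis by (rule image_eqI[OF _ quotientI[OF u]])
  qed
  then have "?v ` ?F \<subseteq> (\<lambda>C. ?v (SOME w. w \<in> C)) ` (?F // ?R)" by blast
  moreover have "finite (?F // ?R)"
    using finite_factors[OF fin] by (simp add: quotient_def)
  ultimately show ?thesis
    unfolding group_complexity_def by (rule surj_card_le[rotated])
qed

text \<open>
  Give each position the coefficient of its orbit. The equation of the hyperplane, applied to the
  factors at all starting positions, then is a linear recurrence for the weights of the letters.
\<close>

lemma orbit_sums_in_hyperplane_imp_periodic:
  assumes H: "subgroup H (sym_group n)" and fin: "finite (range x)" and inj: "inj_on h (range x)"
    and P0: "P0 \<in> point_orbits H n" "c P0 \<noteq> 0"
    and plane: "\<And>u. u \<in> factors x n \<Longrightarrow> (\<Sum>P\<in>point_orbits H n. c P * orbit_sums h H n u P) = d"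
  shows "ultimately_periodic x"
proof -
  let ?J = "point_orbits H n"
  obtain j where j: "j \<in> {1..n}" "P0 = point_orbit H j"
    using P0(1) by (auto simp: point_orbits_def)
  have recurrence: "(\<Sum>i<n. c (point_orbit H (Suc i)) * h (x (m + i))) = d" for m
  proof -
    let ?f = "\<lambda>i. c (point_orbit H i) * h (window x n m ! (i - 1))"
    have "(\<Sum>i<n. c (point_orbit H (Suc i)) * h (x (m + i))) = (\<Sum>i\<in>{1..n}. ?f i)"
      by (rule sum.reindex_bij_witness[of _ "\<lambda>i. i - 1" Suc]) auto
    also have "\<dots> = (\<Sum>P\<in>?J. \<Sum>i\<in>{i \<in> {1..n}. point_orbit H i = P}. ?f i)"
      by (rule sum.group[symmetric]) (auto simp: finite_point_orbits point_orbits_def)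
    also have "\<dots> = (\<Sum>P\<in>?J. c P * orbit_sums h H n (window x n m) P)"
    proof (rule sum.cong)
      fix P assume P: "P \<in> ?J"
      have "(\<Sum>i\<in>{i \<in> {1..n}. point_orbit H i = P}. ?f i)
          = (\<Sum>i\<in>{i \<in> {1..n}. point_orbit H i = P}. c P * h (window x n m ! (i - 1)))"
        by (rule sum.cong) auto
      also have "\<dots> = (\<Sum>i\<in>P. c P * h (window x n m ! (i - 1)))"
        using point_orbit_eq_fibre[OF H P] by simp
      finally show "(\<Sum>i\<in>{i \<in> {1..n}. point_orbit H i = P}. ?f i)
          = c P * orbit_sums h H n (window x n m) P"
        using P by (simp add: orbit_sums_def sum_distrib_left)
    qed simp
    also have "\<dots> = d" by (rule plane) (auto simp: factors_def)
    finally show ?thesis .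
  qed
  have "j - 1 < n" "c (point_orbit H (Suc (j - 1))) \<noteq> 0" using j P0(2) by auto
  then show ?thesis by (rule ultimately_periodic_from_recurrence[OF fin inj _ _ recurrence])
qed

lemma num_orbits_less_card_orbit_sums:
  assumes H: "subgroup H (sym_group n)" and fin: "finite (range x)" and inj: "inj_on h (range x)"
    and "aperiodic x"
  shows "num_orbits n H < card (orbit_sums h H n ` factors x n)"
proof (rule ccontr)
  let ?V = "orbit_sums h H n ` factors x n"
  assume "\<not> ?thesis"
  then have "card ?V \<le> card (point_orbits H n)" by (simp add: num_orbits_eq)
  moreover have "?V \<noteq> {}" by (auto simp: factors_def)
  ultimately obtain c d where "\<exists>P\<in>point_orbits H n. c P \<noteq> 0"
    "\<forall>v\<in>?V. (\<Sum>P\<in>point_orbits H n. c P * v P) = d"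
    using few_points_on_hyperplane[OF finite_point_orbits, of ?V H n] finite_factors[OF fin, of n]
    by blast
  then have "ultimately_periodic x"
    using orbit_sums_in_hyperplane_imp_periodic[OF H fin inj] by blast
  then show False using \<open>aperiodic x\<close> by (simp add: aperiodic_def)
qed

section \<open>Balance and special factors\<close>

abbreviation factor :: "(nat \<Rightarrow> 'a) \<Rightarrow> 'a list \<Rightarrow> bool" where
  "factor x u \<equiv> u \<in> factors x (length u)"

lemma factor_iff: "factor x u \<longleftrightarrow> (\<exists>m. \<forall>k<length u. x (m + k) = u ! k)"
proof -
  have "u = window x (length u) m \<longleftrightarrow> (\<forall>k<length u. x (m + k) = u ! k)" for m
    unfolding list_eq_iff_nth_eq by fastforce
  then show ?thesis unfolding factors_def by blast
qed

lemma factor_window: "factor x (window x l i)"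
  by (auto simp: factors_def)

lemma factor_appendD:
  assumes "factor x (u @ v)"
  shows "factor x u" and "factor x v"
proof -
  obtain m where m: "\<forall>k<length (u @ v). x (m + k) = (u @ v) ! k"
    using assms unfolding factor_iff by blast
  have "\<forall>k<length u. x (m + k) = u ! k"
    using m by (simp add: nth_append)
  then show "factor x u" unfolding factor_iff by blast
  have "x (m + length u + k) = v ! k" if "k < length v" for k
    using m[rule_format, of "length u + k"] that by (simp add: nth_append add.assoc)
  then show "factor x v" unfolding factor_iff by blast
qed

lemma factor_letters:
  assumes "factor x u"
  shows "set u \<subseteq> range x"
proof -
  obtain n where "u \<in> factors x n" using assms by blast
  then show ?thesis by (auto simp: factors_def)
qed

definition balanced_below :: "(nat \<Rightarrow> 'a) \<Rightarrow> nat \<Rightarrow> bool" where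
  "balanced_below x n \<longleftrightarrow> (\<forall>m<n. \<forall>u \<in> factors x m. \<forall>v \<in> factors x m. \<forall>a.
     \<bar>int (count_list u a) - int (count_list v a)\<bar> \<le> 1)"

lemma balanced_belowD:
  assumes "balanced_below x n" and "factor x u" and "factor x v"
    and "length u = length v" and "length u < n"
  shows "count_list u a \<le> count_list v a + 1"
proof -
  have "\<bar>int (count_list u a) - int (count_list v a)\<bar> \<le> 1"
    using assms unfolding balanced_below_def by metis
  then show ?thesis by linarith
qed

lemma balanced_below_mono: "balanced_below x n \<Longrightarrow> m \<le> n \<Longrightarrow> balanced_below x m"
  unfolding balanced_below_def by (metis order_less_le_trans)

text \<open>
  In a shortest pair of factors whose numbers of letters \<open>b\<close> differ by two, nothing can be cut
  off. The first letters must differ, the words then agree up to the next difference, and that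
  difference already completes the imbalance, so it is the last letter.
\<close>

lemma minimal_unbalanced_pair:
  assumes bin: "binary x" and "\<not> balanced x"
  shows "\<exists>a b w. a \<noteq> b \<and> range x = {a, b} \<and> factor x (a # w @ [a]) \<and> factor x (b # w @ [b])
    \<and> balanced_below x (length w + 2)"
proof -
  define unbal where "unbal n u v b \<longleftrightarrow> u \<in> factors x n \<and> v \<in> factors x n
    \<and> count_list u b + 2 \<le> count_list v b" for n u v b
  have unbalI: "\<exists>u v b. unbal n u v b"
    if nb: "\<not> (\<forall>u \<in> factors x n. \<forall>v \<in> factors x n. \<forall>a.
      \<bar>int (count_list u a) - int (count_list v a)\<bar> \<le> 1)" for n
  proof -
    obtain u v a where uv: "u \<in> factors x n" "v \<in> factors x n"
      "\<not> \<bar>int (count_list u a) - int (count_list v a)\<bar> \<le> 1"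
      using nb by blast
    then have "count_list u a + 2 \<le> count_list v a \<or> count_list v a + 2 \<le> count_list u a"
      by linarith
    then show ?thesis unfolding unbal_def using uv(1,2) by blast
  qed
  then have ex: "\<exists>n u v b. unbal n u v b"
    using \<open>\<not> balanced x\<close> unfolding balanced_def by blast
  define n where "n = (LEAST n. \<exists>u v b. unbal n u v b)"
  obtain u v b where uv: "unbal n u v b"
    using LeastI_ex[OF ex] unfolding n_def by blast
  have below: "balanced_below x n"
    unfolding balanced_below_def using unbalI not_less_Least unfolding n_def by blast
  have len: "length u = n" "length v = n" and fac: "factor x u" "factor x v"
    and count: "count_list u b + 2 \<le> count_list v b"
    using uv by (auto simp: unbal_def factors_def)
  have "b \<in> set v" using count by (metis add_leE count_list_0_iff not_numeral_le_zero le_zero_eq)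
  then have "b \<in> range x" using factor_letters[OF fac(2)] by blast
  moreover obtain c d where "range x = {c, d}" "c \<noteq> d"
    using bin unfolding binary_def card_2_iff by blast
  ultimately obtain a where a: "range x = {a, b}" "a \<noteq> b"
    by (metis doubleton_eq_iff insert_iff singletonD)
  \<comment> \<open>By minimality, cutting off the first letters or a common prefix must destroy the imbalance.\<close>
  have "v \<noteq> []" using count by auto
  then obtain c u' d v' where cons: "u = c # u'" "v = d # v'"
    using len by (metis length_0_conv list.exhaust)
  have fac': "factor x u'" "factor x v'"
    using factor_appendD(2)[of "[c]" u' x] factor_appendD(2)[of "[d]" v' x] fac cons by auto
  have len': "length u' = length v'" "length v' < n" using len cons by auto
  have le: "count_list v' b \<le> count_list u' b + 1"
    using balanced_belowD[OF below fac'(2,1)] len' by auto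
  have cd: "c = a" "d = b"
    using factor_letters[OF fac(1)] factor_letters[OF fac(2)] cons a count le
    by (auto split: if_splits)
  have count': "count_list v' b = count_list u' b + 1"
    using count le cons cd a by auto
  then have "u' \<noteq> v'" by auto
  then obtain w e u'' f v'' where split: "e \<noteq> f" "u' = w @ [e] @ u''" "v' = w @ [f] @ v''"
    using same_length_different[OF _ len'(1)] by blast
  have fac'': "factor x u''" "factor x v''"
    using fac' factor_appendD(2)[of "w @ [e]" u'' x] factor_appendD(2)[of "w @ [f]" v'' x] split
    by auto
  have len'': "length u'' = length v''" "length v'' < n" using len' split by auto
  have "count_list v'' b \<le> count_list u'' b + 1"
    using balanced_belowD[OF below fac''(2,1)] len'' by auto
  moreover have "e \<in> {a, b}" "f \<in> {a, b}"
    using factor_letters[OF fac'(1)] factor_letters[OF fac'(2)] split a by auto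
  ultimately have ef: "e = a" "f = b"
    using count' split a by (auto split: if_splits)
  have "u = (a # w @ [a]) @ u''" "v = (b # w @ [b]) @ v''"
    using cons cd split ef by auto
  then have "factor x (a # w @ [a])" "factor x (b # w @ [b])"
    using fac factor_appendD(1) by metis+
  moreover have "length w + 2 \<le> n" using len cons split by auto
  ultimately show ?thesis
    using a balanced_below_mono[OF below] by blast
qed

text \<open>
  At the first place where \<open>w\<close> and its reversal disagree, a prefix of one of \<open>awa\<close>, \<open>bwb\<close> and a
  suffix of the other have interiors that are reversals of each other, but begin and end with \<open>a\<close>
  in one case and with \<open>b\<close> in the other. They would be a shorter unbalanced pair.
\<close>

lemma unbalanced_core_palindrome:
  assumes "a \<noteq> b" and "range x = {a, b}"
    and awa: "factor x (a # w @ [a])" and bwb: "factor x (b # w @ [b])"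
    and below: "balanced_below x (length w + 2)"
  shows "rev w = w"
proof (rule ccontr)
  assume "rev w \<noteq> w"
  then obtain z c w1 d w2 where split: "c \<noteq> d" "rev w = z @ [c] @ w1" "w = z @ [d] @ w2"
    using same_length_different[of "rev w" w] by auto
  have w: "w = rev w1 @ [c] @ rev z" using split(2) by (metis append.assoc rev_append rev_rev_ident rev_singleton_conv)
  have short: "length z + 2 < length w + 2" using split(3) by simp
  have pre: "factor x (l # z @ [d])" if "factor x (l # w @ [l])" for l
    using factor_appendD(1)[of "l # z @ [d]" "w2 @ [l]" x] that split(3) by simp
  have suf: "factor x ([c] @ rev z @ [l])" if "factor x (l # w @ [l])" for l
    using factor_appendD(2)[of "l # rev w1" "[c] @ rev z @ [l]" x] that w by simp
  have "{c, d} \<subseteq> {a, b}"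
    using factor_letters[OF pre[OF awa]] factor_letters[OF suf[OF awa]] assms(2) by auto
  then consider "c = b" "d = a" | "c = a" "d = b" using split(1) by blast
  then show False
  proof cases
    case 1
    then show False
      using balanced_belowD[OF below suf[OF bwb] pre[OF awa], of b] short \<open>a \<noteq> b\<close> by simp
  next
    case 2
    then show False
      using balanced_belowD[OF below pre[OF bwb] suf[OF awa], of b] short \<open>a \<noteq> b\<close> by simp
  qed
qed

text \<open>
  If two right special factors first differ, read from the right, to the left of a common suffix
  \<open>v\<close>, then \<open>ava\<close> and \<open>bvb\<close> are factors, which contradicts balance.
\<close>

lemma right_special_unique:
  assumes "a \<noteq> b" and "range x = {a, b}"
    and s: "factor x (s @ [a])" "factor x (s @ [b])"
    and t: "factor x (t @ [a])" "factor x (t @ [b])"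
    and len: "length s = length t" and below: "balanced_below x (length s + 2)"
  shows "s = t"
proof (rule ccontr)
  assume "s \<noteq> t"
  then obtain z c s' d t' where "c \<noteq> d" "rev s = z @ [c] @ s'" "rev t = z @ [d] @ t'"
    using same_length_different[of "rev s" "rev t"] len by auto
  then have cd: "c \<noteq> d" "s = rev s' @ [c] @ rev z" "t = rev t' @ [d] @ rev z"
    by (metis append.assoc rev_append rev_rev_ident rev_singleton_conv)+
  have fs: "factor x ([c] @ rev z @ [l])" if "factor x (s @ [l])" for l
    using factor_appendD(2)[of "rev s'" "[c] @ rev z @ [l]" x] that cd(2) by simp
  have ft: "factor x ([d] @ rev z @ [l])" if "factor x (t @ [l])" for l
    using factor_appendD(2)[of "rev t'" "[d] @ rev z @ [l]" x] that cd(3) by simp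
  have short: "length z + 2 < length s + 2" using cd by simp
  have "{c, d} \<subseteq> {a, b}"
    using factor_letters[OF fs[OF s(1)]] factor_letters[OF ft[OF t(1)]] assms(2) by auto
  then consider "c = b" "d = a" | "c = a" "d = b" using cd(1) by blast
  then show False
  proof cases
    case 1
    then show False
      using balanced_belowD[OF below fs[OF s(2)] ft[OF t(1)], of b] short \<open>a \<noteq> b\<close> by simp
  next
    case 2
    then show False
      using balanced_belowD[OF below ft[OF t(2)] fs[OF s(1)], of b] short \<open>a \<noteq> b\<close> by simp
  qed
qed

text \<open>
  Passing from length \<open>l\<close> to \<open>l + 1\<close>, every factor has one extension to the right, except for at
  most one right special factor, which has two.
\<close>

lemma card_factors_le:
  assumes "a \<noteq> b" and "range x = {a, b}" and "balanced_below x (l + 1)"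
  shows "card (factors x l) \<le> l + 1"
  using assms(3)
proof (induction l)
  case 0
  have "factors x 0 = {[]}" by (auto simp: factors_def)
  then show ?case by simp
next
  case (Suc l)
  have fin: "finite (factors x l)" using finite_factors[of x l] assms(2) by simp
  have IH: "card (factors x l) \<le> l + 1"
    using Suc.IH balanced_below_mono[OF Suc.prems] by simp
  define spec where "spec z \<longleftrightarrow> length z = l \<and> factor x (z @ [a]) \<and> factor x (z @ [b])" for z
  define r where "r = (SOME z. spec z)"
  define f where "f z = (if factor x (z @ [a]) then a else b)" for z
  have r: "z = r" if "spec z" for z
  proof -
    have "spec r" unfolding r_def using that by (rule someI)
    then show ?thesis
      using right_special_unique[OF assms(1,2), of z r] that Suc.prems unfolding spec_def by auto
  qed
  have "factors x (Suc l) \<subseteq> insert (r @ [b]) ((\<lambda>z. z @ [f z]) ` factors x l)"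
  proof
    fix v assume v: "v \<in> factors x (Suc l)"
    then have "length v = Suc l" by (auto simp: factors_def)
    then obtain z c where zc: "v = z @ [c]" "length z = l"
      by (metis length_Suc_conv_rev)
    have fv: "factor x (z @ [c])" using v zc by simp
    then have z: "z \<in> factors x l" using factor_appendD(1)[of z "[c]" x] zc(2) by simp
    have "c \<in> {a, b}" using factor_letters[OF fv] assms(2) by auto
    then have "c = f z \<or> c = b \<and> spec z" using fv zc by (auto simp: f_def spec_def)
    then show "v \<in> insert (r @ [b]) ((\<lambda>z. z @ [f z]) ` factors x l)"
      using zc z r by auto
  qed
  then have "card (factors x (Suc l)) \<le> card (insert (r @ [b]) ((\<lambda>z. z @ [f z]) ` factors x l))"
    using fin by (intro card_mono) auto
  also have "\<dots> \<le> Suc (card ((\<lambda>z. z @ [f z]) ` factors x l))"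
    by (rule card_insert_le_m1) auto
  also have "\<dots> \<le> Suc (card (factors x l))" using card_image_le[OF fin] by simp
  finally show ?case using IH by simp
qed

text \<open>
  Suppose that \<open>bwa\<close> is not a factor. Then only \<open>aw\<close> can be a right special factor of length
  \<open>l = |w| + 1\<close>. Since \<open>w\<close> is a palindrome, \<open>aw\<close> does not begin inside an occurrence of \<open>bwb\<close>, so
  the \<open>l + 1\<close> windows of length \<open>l\<close> beginning there avoid it. But at most \<open>l\<close> factors of this length
  other than \<open>aw\<close> exist: a window is repeated before the word had any choice, and the word is
  ultimately periodic.
\<close>

lemma both_extensions_of_core:
  assumes "aperiodic x" and "a \<noteq> b" and rng: "range x = {a, b}"
    and awa: "factor x (a # w @ [a])" and bwb: "factor x (b # w @ [b])"
    and below: "balanced_below x (length w + 2)"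
  shows "factor x (b # w @ [a])"
proof (rule ccontr)
  assume bwa: "\<not> factor x (b # w @ [a])"
  define l where "l = length w + 1"
  have pal: "rev w = w"
    using unbalanced_core_palindrome[OF assms(2-6)] .
  have special: "t = a # w" if t: "factor x (t @ [a])" "factor x (t @ [b])" and len: "length t = l"
    for t
  proof -
    obtain c t' where ct: "t = c # t'" "length t' = length w"
      using len unfolding l_def by (metis Suc_eq_plus1 length_Suc_conv)
    have "factor x (t' @ [a])" "factor x (t' @ [b])"
      using t factor_appendD(2)[of "[c]" "t' @ [a]" x] factor_appendD(2)[of "[c]" "t' @ [b]" x] ct
      by auto
    moreover have "factor x (w @ [a])" "factor x (w @ [b])"
      using awa bwb factor_appendD(2)[of "[a]" "w @ [a]" x] factor_appendD(2)[of "[b]" "w @ [b]" x]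
      by auto
    ultimately have "t' = w"
      using right_special_unique[OF assms(2,3), of t' w] below ct by simp
    moreover have "c \<in> {a, b}" using factor_letters[OF t(1)] ct rng by auto
    ultimately show ?thesis using ct t bwa by auto
  qed
  obtain m where m: "\<forall>k<length (b # w @ [b]). x (m + k) = (b # w @ [b]) ! k"
    using bwb unfolding factor_iff by blast
  \<comment> \<open>If \<open>aw\<close> began in the middle of \<open>bwb\<close>, the first letter \<open>a\<close> of the overlap and its last
    letter \<open>b\<close> would stand at mirror positions of \<open>w\<close>.\<close>
  have no_aw: "window x l (m + j) \<noteq> a # w" if j: "j \<le> l" for j
  proof
    assume "window x l (m + j) = a # w"
    then have aw: "x (m + j + k) = (a # w) ! k" if "k < l" for k
      using that by (metis nth_map_upt add_diff_cancel_left')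
    have "x (m + j) = a" using aw[of 0] by (simp add: l_def)
    moreover have "x (m + 0) = b" "x (m + l) = b"
      using m[rule_format, of 0] m[rule_format, of l] by (simp_all add: l_def nth_append)
    ultimately have "j \<noteq> 0" "j \<noteq> l"
      using \<open>a \<noteq> b\<close> by metis+
    then obtain i where i: "j = Suc i" "i < length w"
      using j by (cases j) (auto simp: l_def)
    have wi: "w ! i = a"
      using m[rule_format, of j] i \<open>x (m + j) = a\<close> by (simp add: nth_append)
    have "w ! (length w - Suc i) = b"
      using m[rule_format, of l] aw[of "l - j"] i by (simp add: l_def nth_append nth_Cons' add.assoc)
    moreover have "w ! (length w - Suc i) = w ! i"
      using rev_nth[OF i(2)] pal by simp
    ultimately show False using wi \<open>a \<noteq> b\<close> by simp
  qed
  have "window x l ` {m..m + l} \<subseteq> factors x l - {a # w}"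
  proof
    fix u assume "u \<in> window x l ` {m..m + l}"
    then obtain k where k: "m \<le> k" "k \<le> m + l" "u = window x l k" by auto
    then have "k = m + (k - m)" "k - m \<le> l" by simp_all
    then have "u \<noteq> a # w" using no_aw[of "k - m"] k(3) by simp
    moreover have "u \<in> factors x l" using k(3) unfolding factors_def by blast
    ultimately show "u \<in> factors x l - {a # w}" by blast
  qed
  then have "card (window x l ` {m..m + l}) \<le> card (factors x l - {a # w})"
    using finite_factors[of x l] rng by (intro card_mono) auto
  also have "\<dots> < card (factors x l)"
  proof (rule card_Diff1_less)
    show "finite (factors x l)" using finite_factors[of x l] rng by simp
    show "a # w \<in> factors x l" using factor_appendD(1)[of "a # w" "[a]" x] awa by (simp add: l_def)
  qed
  also have "\<dots> \<le> card {m..m + l}"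
    using card_factors_le[OF assms(2,3), of l] below by (simp add: l_def)
  finally have "\<not> inj_on (window x l) {m..m + l}" by (metis card_image less_irrefl)
  then obtain i j where ij: "i < j" "m \<le> i" "j \<le> m + l" "window x l i = window x l j"
    unfolding inj_on_def by (metis atLeastAtMost_iff linorder_neqE_nat)
  have "ultimately_periodic x"
  proof (rule ultimately_periodic_from_windows[OF _ ij(1,4)])
    show "0 < l" by (simp add: l_def)
    fix k p assume k: "i \<le> k" "k < j" and eq: "window x l p = window x l k"
    show "x (p + l) = x (k + l)"
    proof (rule ccontr)
      assume neq: "x (p + l) \<noteq> x (k + l)"
      have ext: "factor x (window x l q @ [x (q + l)])" for q
      proof -
        have "window x l q @ [x (q + l)] = window x (Suc l) q" by simp
        then show ?thesis using factor_window by metis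
      qed
      have "x (p + l) \<in> {a, b}" "x (k + l) \<in> {a, b}" using rng by blast+
      then have "factor x (window x l k @ [a])" "factor x (window x l k @ [b])"
        using ext[of p] ext[of k] eq neq by auto
      then have "window x l k = a # w" by (rule special) simp
      moreover have "k - m \<le> l" "m + (k - m) = k" using k ij by simp_all
      ultimately show False using no_aw[of "k - m"] by simp
    qed
  qed
  then show False using \<open>aperiodic x\<close> by (simp add: aperiodic_def)
qed

section \<open>The group complexity of a non-Sturmian word\<close>

lemma orbit_sums_neqI:
  assumes H: "subgroup H (sym_group n)"
    and le: "\<And>p. p < n \<Longrightarrow> h (u ! p) \<le> h (v ! p)" and "q < n" and "h (u ! q) < h (v ! q)"
  shows "orbit_sums h H n u \<noteq> orbit_sums h H n v"
proof -
  define P where "P = point_orbit H (Suc q)"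
  have P: "P \<in> point_orbits H n"
    using \<open>q < n\<close> by (auto simp: P_def point_orbits_def)
  then have sub: "P \<subseteq> {1..n}" using point_orbit_eq_fibre[OF H] by blast
  have "(\<Sum>i\<in>P. h (u ! (i - 1))) < (\<Sum>i\<in>P. h (v ! (i - 1)))"
  proof (rule sum_strict_mono_ex1)
    show "finite P" using sub finite_subset by blast
    have "i - 1 < n" if "i \<in> P" for i
    proof -
      have "1 \<le> i" "i \<le> n" using sub that by auto
      then show ?thesis by simp
    qed
    then show "\<forall>i\<in>P. h (u ! (i - 1)) \<le> h (v ! (i - 1))" using le by blast
    show "\<exists>i\<in>P. h (u ! (i - 1)) < h (v ! (i - 1))"
      using point_orbit_self[OF H, of "Suc q"] \<open>h (u ! q) < h (v ! q)\<close> unfolding P_def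
      by (intro bexI[of _ "Suc q"]) simp_all
  qed
  then have "orbit_sums h H n u P < orbit_sums h H n v P"
    using P by (simp add: orbit_sums_def)
  then show ?thesis by auto
qed

text \<open>
  With \<open>k + 1\<close> vectors or fewer, at most \<open>k\<close> remain when the vector of \<open>bwb\<close> is left out, and
  these lie on a hyperplane. It contains the omitted vector as well, which is an affine combination
  of the vectors of \<open>awb\<close>, \<open>bwa\<close> and \<open>awa\<close>. When the first and the last position are in
  the same orbit, the vectors of \<open>awb\<close> and \<open>bwa\<close> coincide and the parallelogram degenerates, but
  the vector of \<open>bwb\<close> still differs from the other ones.
\<close>

lemma unbalanced_core_excess_orbit_sums:
  assumes H: "subgroup H (sym_group n)" and n: "n = length w + 2" and "aperiodic x"
    and fin: "finite (range x)" and inj: "inj_on h (range x)" and ab: "h a < h b"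
    and fac: "factor x (a # w @ [a])" "factor x (a # w @ [b])"
      "factor x (b # w @ [a])" "factor x (b # w @ [b])"
  shows "num_orbits n H + 1 < card (orbit_sums h H n ` factors x n)"
proof (rule ccontr)
  let ?V = "orbit_sums h H n ` factors x n" and ?J = "point_orbits H n"
  define f where "f l r = orbit_sums h H n (l # w @ [r])" for l r
  assume "\<not> ?thesis"
  then have "card ?V \<le> card ?J + 1" by (simp add: num_orbits_eq)
  have f: "f a a \<in> ?V" "f a b \<in> ?V" "f b a \<in> ?V" "f b b \<in> ?V"
    using fac n by (simp_all add: f_def)
  \<comment> \<open>\<open>bwb\<close> is heavier than \<open>awr\<close> at the first position, and than \<open>bwa\<close> at the last one.\<close>
  have "f a r \<noteq> f b b" if "h r \<le> h b" for r
    unfolding f_def using ab n that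
    by (intro orbit_sums_neqI[OF H, where q = 0]) (auto simp: nth_Cons' nth_append)
  moreover have "f b a \<noteq> f b b"
    unfolding f_def using ab n
    by (intro orbit_sums_neqI[OF H, where q = "n - 1"]) (auto simp: nth_Cons' nth_append)
  ultimately have neq: "f a a \<noteq> f b b" "f a b \<noteq> f b b" "f b a \<noteq> f b b"
    using ab by simp_all
  \<comment> \<open>The identity already holds letter by letter.\<close>
  have parallelogram: "f b b P = f a b P + f b a P - f a a P" if P: "P \<in> ?J" for P
  proof -
    have "h ((b # w @ [b]) ! (i - 1)) + h ((a # w @ [a]) ! (i - 1))
        = h ((a # w @ [b]) ! (i - 1)) + h ((b # w @ [a]) ! (i - 1))" if "i \<in> P" for i
    proof -
      have "1 \<le> i" "i \<le> n" using point_orbit_eq_fibre[OF H P] that by auto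
      then have "i - 1 < length w + 2" using n by simp
      then show ?thesis by (cases "i - 1") (auto simp: nth_append less_Suc_eq)
    qed
    then have "(\<Sum>i\<in>P. h ((b # w @ [b]) ! (i - 1)) + h ((a # w @ [a]) ! (i - 1)))
        = (\<Sum>i\<in>P. h ((a # w @ [b]) ! (i - 1)) + h ((b # w @ [a]) ! (i - 1)))"
      by (rule sum.cong[OF refl])
    then show ?thesis using P by (simp add: f_def orbit_sums_def sum.distrib)
  qed
  let ?V' = "?V - {f b b}"
  have "finite ?V" using finite_factors[OF fin, of n] by blast
  moreover from this have "card ?V' \<le> card ?J"
    using f(4) \<open>card ?V \<le> card ?J + 1\<close> by simp
  moreover have "?V' \<noteq> {}" using f(1) neq(1) by blast
  ultimately obtain c d where c: "\<exists>P\<in>?J. c P \<noteq> 0"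
    and plane: "\<forall>v\<in>?V'. (\<Sum>P\<in>?J. c P * v P) = d"
    using few_points_on_hyperplane[OF finite_point_orbits, of ?V' H n] by blast
  have "(\<Sum>P\<in>?J. c P * f b b P) = (\<Sum>P\<in>?J. c P * f a b P + c P * f b a P - c P * f a a P)"
    by (rule sum.cong) (simp_all add: parallelogram algebra_simps)
  also have "\<dots> = d + d - d"
    using plane f(1-3) neq by (simp add: sum.distrib sum_subtractf)
  finally have "\<forall>v\<in>?V. (\<Sum>P\<in>?J. c P * v P) = d" using plane by auto
  then have "ultimately_periodic x"
    using c orbit_sums_in_hyperplane_imp_periodic[OF H fin inj] by blast
  then show False using \<open>aperiodic x\<close> by (simp add: aperiodic_def)
qed

lemma minimal_complexity_imp_balanced:
  fixes h :: "'a \<Rightarrow> real"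
  assumes sub: "\<forall>n\<ge>1. subgroup (\<omega> n) (sym_group n)" and "aperiodic x" and "binary x"
    and fin: "finite (range x)" and inj: "inj_on h (range x)"
    and min: "\<forall>n\<ge>1. group_complexity \<omega> x n = num_orbits n (\<omega> n) + 1"
  shows "balanced x"
proof (rule ccontr)
  assume "\<not> balanced x"
  then obtain a b w where ab: "a \<noteq> b" "range x = {a, b}"
    and w: "factor x (a # w @ [a])" "factor x (b # w @ [b])" "balanced_below x (length w + 2)"
    using minimal_unbalanced_pair[OF \<open>binary x\<close>] by blast
  have bwa: "factor x (b # w @ [a])"
    using both_extensions_of_core[OF \<open>aperiodic x\<close> ab w] .
  have "b \<noteq> a" "range x = {b, a}" using ab by auto
  then have awb: "factor x (a # w @ [b])"
    using both_extensions_of_core[OF \<open>aperiodic x\<close> _ _ w(2,1,3)] by blast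
  define n where "n = length w + 2"
  have H: "subgroup (\<omega> n) (sym_group n)" using sub by (simp add: n_def)
  have "h a \<noteq> h b" using inj ab by (auto dest: inj_onD)
  \<comment> \<open>The four factors are symmetric in \<open>a\<close> and \<open>b\<close>, so either letter may be the heavier one.\<close>
  then have "h a < h b \<or> h b < h a" by linarith
  then have "num_orbits n (\<omega> n) + 1 < card (orbit_sums h (\<omega> n) n ` factors x n)"
    using unbalanced_core_excess_orbit_sums[OF H n_def \<open>aperiodic x\<close> fin inj] w(1,2) awb bwa
    by blast
  also have "\<dots> \<le> group_complexity \<omega> x n"
    by (rule card_orbit_sums_le_group_complexity[where \<omega> = \<omega>, OF H fin])
  finally show False using min by (simp add: n_def)
qed

lemma minimal_complexity_imp_binary:
  fixes h :: "'a \<Rightarrow> real"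
  assumes H: "subgroup (\<omega> 1) (sym_group 1)" and "aperiodic x"
    and fin: "finite (range x)" and inj: "inj_on h (range x)"
    and min: "group_complexity \<omega> x 1 = num_orbits 1 (\<omega> 1) + 1"
  shows "binary x"
proof -
  let ?H = "\<omega> 1" and ?V = "orbit_sums h (\<omega> 1) 1 ` factors x 1"
  have one: "num_orbits 1 ?H = 1"
    by (simp add: num_orbits_eq point_orbits_def)
  have J: "{1} \<in> point_orbits ?H 1"
  proof -
    have P: "point_orbit ?H 1 \<in> point_orbits ?H 1" by (simp add: point_orbits_def)
    moreover have "point_orbit ?H 1 = {1}"
      using point_orbit_eq_fibre[OF H P] point_orbit_self[OF H, of 1] by auto
    ultimately show ?thesis by simp
  qed
  have "?V = (\<lambda>c. orbit_sums h ?H 1 [c]) ` range x"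
    by (auto simp: factors_def image_iff)
  moreover have "inj_on (\<lambda>c. orbit_sums h ?H 1 [c]) (range x)"
  proof (rule inj_onI)
    fix c d assume "c \<in> range x" "d \<in> range x" "orbit_sums h ?H 1 [c] = orbit_sums h ?H 1 [d]"
    moreover from this(3) have "h c = h d"
      using J by (auto simp: orbit_sums_def dest: fun_cong[of _ _ "{1}"])
    ultimately show "c = d" using inj by (auto dest: inj_onD)
  qed
  ultimately have "card ?V = card (range x)" by (simp add: card_image)
  moreover have "card ?V \<le> 2"
    using card_orbit_sums_le_group_complexity[where \<omega> = \<omega> and h = h, OF H fin] min one by simp
  moreover have "1 < card ?V"
    using num_orbits_less_card_orbit_sums[OF H fin inj \<open>aperiodic x\<close>] one by simp
  ultimately show ?thesis by (simp add: binary_def)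
qed

theorem theorem1:
  fixes A :: "'a set" and x :: "nat \<Rightarrow> 'a" and \<omega> :: "nat \<Rightarrow> (nat \<Rightarrow> nat) set"
  assumes "finite A" and "A \<noteq> {}" and "\<forall>i. x i \<in> A"
    and "aperiodic x"
    and "\<forall>n\<ge>1. subgroup (\<omega> n) (sym_group n)"
  shows "(\<forall>n\<ge>1. group_complexity \<omega> x n \<ge> num_orbits n (\<omega> n) + 1) \<and>
    ((\<forall>n\<ge>1. group_complexity \<omega> x n = num_orbits n (\<omega> n) + 1) \<longrightarrow> sturmian x)"
proof (intro conjI allI impI)
  have fin: "finite (range x)" using assms(1,3) by (auto intro: finite_subset)
  then obtain e :: "'a \<Rightarrow> nat" where e: "inj_on e (range x)"
    using finite_imp_inj_to_nat_seg by metis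
  define h where "h c = real (e c)" for c
  have inj: "inj_on h (range x)" using e by (auto simp: h_def inj_on_def)
  {
    fix n :: nat assume "1 \<le> n"
    then have H: "subgroup (\<omega> n) (sym_group n)" using assms(5) by blast
    show "num_orbits n (\<omega> n) + 1 \<le> group_complexity \<omega> x n"
      using num_orbits_less_card_orbit_sums[OF H fin inj assms(4)]
        card_orbit_sums_le_group_complexity[where \<omega> = \<omega> and h = h, OF H fin] by linarith
  next
    assume min: "\<forall>n\<ge>1. group_complexity \<omega> x n = num_orbits n (\<omega> n) + 1"
    have "binary x"
      using minimal_complexity_imp_binary[where \<omega> = \<omega>, OF _ assms(4) fin inj] assms(5) min by blast
    then show "sturmian x"
      using minimal_complexity_imp_balanced[OF assms(5,4) _ fin inj min] assms(4)
      by (simp add: sturmian_def)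
  }
qed

end
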